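(* Let $G_A$ and $G_B$ be integrally invertible graphs on $n$ and $m$ vertices, with adjacency matrices $A$ and $B$, respectively. Let $R$ be the upper left $k\times k$ principal submatrix of $B^{-1}$ and let $P$ be the lower right $k\times k$ principal submatrix of $A^{-1}$. Let $G_C=\mathcal{B}_k(G_A,G_B)$ be the graph obtained by bridging $G_A$ and $G_B$ over the last $k$ vertices of $G_A$ and the first $k$ vertices of $G_B$. If $PR=0$ or $PR=2I$, where $I$ is the $k\times k$ identity matrix, then the graph $G_C$ is integrally invertible.
   Context: Graphs are finite and undirected, possibly with multiple edges; the adjacency matrix $A$ of a graph $G_A$ is a symmetric matrix with nonnegative integer entries, and $G_A$ denotes the graph with adjacency matrix $A$. $G_A$ is integrally invertible if $A^{-1}$ exists and has integer entries. Bridging: for graphs $G_A$, $G_B$ on $n$ and $m$ vertices and $1\le k\le \min(n,m)$, $\mathcal{B}_k(G_A,G_B)$ is the graph $G_C$ on $n+m$ vertices with adjacency matrix $$C=\begin{pmatrix} A & H\\ H^T & B\end{pmatrix},\qquad H=\begin{pmatrix}0&0\\ I&0\end{pmatrix},$$ where $H$ is $n\times m$ and $I$ is the $k\times k$ identity matrix placed in the last $k$ rows and first $k$ columns of $H$; that is, the $i$-th of the last $k$ vertices of $G_A$ is joined by an edge to the $i$-th vertex of $G_B$, $i=1,\dots,k$. *)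

theory Defs
  imports
    Complex_Main
    "Jordan_Normal_Form.Gauss_Jordan_Elimination"
    "Jordan_Normal_Form.DL_Submatrix"
begin

text \<open>
  A graph on the vertices \<open>0, \<dots>, n - 1\<close> is represented by its adjacency matrix. The entries are
  real so that the inverse is the ordinary inverse over a field. Multiple edges are allowed, and
  the diagonal is not required to vanish.
\<close>

definition adjacency_matrix :: "nat \<Rightarrow> real mat \<Rightarrow> bool" where
  "adjacency_matrix n A \<longleftrightarrow>
     A \<in> carrier_mat n n \<and> transpose_mat A = A \<and> elements_mat A \<subseteq> \<nat>"

definition integrally_invertible :: "real mat \<Rightarrow> bool" where
  "integrally_invertible A \<longleftrightarrow> (\<exists>A'. mat_inverse A = Some A' \<and> elements_mat A' \<subseteq> \<int>)"

text \<open>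
  Subtraction on \<open>nat\<close> truncates, so \<open>bridge_block n m k\<close> is an \<open>n \<times> m\<close> matrix only if
  \<open>k \<le> n\<close> and \<open>k \<le> m\<close>.
\<close>

definition bridge_block :: "nat \<Rightarrow> nat \<Rightarrow> nat \<Rightarrow> real mat" where
  "bridge_block n m k =
     four_block_mat (0\<^sub>m (n - k) k) (0\<^sub>m (n - k) (m - k))
                    (1\<^sub>m k)         (0\<^sub>m k (m - k))"

definition bridge :: "nat \<Rightarrow> real mat \<Rightarrow> real mat \<Rightarrow> real mat" where
  "bridge k A B =
     (let H = bridge_block (dim_row A) (dim_row B) k
      in four_block_mat A H (transpose_mat H) B)"

end

theory Submission
  imports Defs "Jordan_Normal_Form.Determinant"
begin

text \<open>
  Write \<open>C = [[A, H], [H\<^sup>T, B]]\<close> for the adjacency matrix of the bridged graph. Since \<open>A\<close> is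
  invertible, \<open>C\<close> is invertible as soon as the Schur complement \<open>B - H\<^sup>T A\<^sup>-\<^sup>1 H\<close> is, and
  then \<open>C\<^sup>-\<^sup>1\<close> is built by ring operations from \<open>A\<^sup>-\<^sup>1\<close>, \<open>H\<close> and the inverse of that
  complement (\<open>four_block_mat_right_inverse\<close>). So it suffices that the Schur complement has an
  inverse with integer entries.

  The Schur complement factors as \<open>(1 - L) B\<close> with \<open>L = H\<^sup>T A\<^sup>-\<^sup>1 H B\<^sup>-\<^sup>1\<close>, an integer matrix.
  Multiplication by \<open>H\<^sup>T\<close> and \<open>H\<close> moves the lower right \<open>k \<times> k\<close> block \<open>P\<close> of \<open>A\<^sup>-\<^sup>1\<close> to
  the upper left corner and annihilates the rest (\<open>bridge_block_congruence\<close>). Hence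
  \<open>L = [[P R, P N], [0, 0]]\<close>, where \<open>N\<close> is the part of \<open>B\<^sup>-\<^sup>1\<close> to the right of \<open>R\<close>, and
  \<open>L\<^sup>2 = [[P R P R, P R P N], [0, 0]]\<close>. So \<open>P R = 0\<close> gives \<open>L\<^sup>2 = 0\<close>, and
  \<open>P R = 2 I\<close> gives \<open>L\<^sup>2 = 2 L\<close> (\<open>corner_product_square\<close>).

  In the first case \<open>(1 - L) (1 + L) = 1\<close>; in the second \<open>1 - L\<close> is an involution. In both,
  \<open>1 - L\<close> has an integer inverse \<open>J\<close> (\<open>one_minus_right_inverse\<close>), and \<open>B\<^sup>-\<^sup>1 J\<close> is the
  integer inverse of the Schur complement.
\<close>

section \<open>Integer matrices and inverses\<close>

lemma elements_mat_subset_iff: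
  "elements_mat M \<subseteq> S \<longleftrightarrow> (\<forall>i<dim_row M. \<forall>j<dim_col M. M $$ (i, j) \<in> S)"
  by (fastforce intro: elements_matI[OF carrier_matI])

lemma elements_mat_add_Ints:
  assumes "M \<in> carrier_mat r c" "N \<in> carrier_mat r c"
    and "elements_mat M \<subseteq> \<int>" "elements_mat N \<subseteq> \<int>"
  shows "elements_mat (M + N) \<subseteq> \<int>"
  using assms by (auto simp: elements_mat_subset_iff)

lemma elements_mat_minus_Ints:
  assumes "M \<in> carrier_mat r c" "N \<in> carrier_mat r c"
    and "elements_mat M \<subseteq> \<int>" "elements_mat N \<subseteq> \<int>"
  shows "elements_mat (M - N) \<subseteq> \<int>"
  using assms by (auto simp: elements_mat_subset_iff)

lemma elements_mat_uminus_Ints: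
  "elements_mat M \<subseteq> \<int> \<Longrightarrow> elements_mat (- M) \<subseteq> \<int>"
  by (auto simp: elements_mat_subset_iff)

lemma elements_mat_mult_Ints:
  assumes "M \<in> carrier_mat r s" "N \<in> carrier_mat s c"
    and "elements_mat M \<subseteq> \<int>" "elements_mat N \<subseteq> \<int>"
  shows "elements_mat (M * N) \<subseteq> \<int>"
  using assms
  by (simp add: elements_mat_subset_iff scalar_prod_def) (auto intro!: Ints_sum Ints_mult)

lemma elements_mat_one_subset:
  "0 \<in> S \<Longrightarrow> 1 \<in> S \<Longrightarrow> elements_mat (1\<^sub>m d) \<subseteq> S"
  by (auto simp: elements_mat_subset_iff)

lemma elements_mat_zero_subset:
  "0 \<in> S \<Longrightarrow> elements_mat (0\<^sub>m r c) \<subseteq> S"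
  by (auto simp: elements_mat_subset_iff)

lemma elements_mat_transpose: "elements_mat (transpose_mat M) = elements_mat M"
  unfolding set_eq_subset elements_mat_subset_iff by (auto intro: elements_matI[OF carrier_matI])

lemma elements_mat_four_block_subset:
  assumes "M1 \<in> carrier_mat r1 c1" "M2 \<in> carrier_mat r1 c2"
    "M3 \<in> carrier_mat r2 c1" "M4 \<in> carrier_mat r2 c2"
    and "elements_mat M1 \<subseteq> S" "elements_mat M2 \<subseteq> S"
    "elements_mat M3 \<subseteq> S" "elements_mat M4 \<subseteq> S"
  shows "elements_mat (four_block_mat M1 M2 M3 M4) \<subseteq> S"
  using assms by (auto simp: elements_mat_subset_iff)

text \<open>
  The Gauss-Jordan inverse is only known to be some two-sided inverse, so it is identified with a
  given right inverse through uniqueness; this is what makes entries of the inverse accessible.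
\<close>

lemma mat_inverse_eq_SomeI:
  fixes M N :: "'a :: field mat"
  assumes M: "M \<in> carrier_mat d d" and N: "N \<in> carrier_mat d d" and MN: "M * N = 1\<^sub>m d"
  shows "mat_inverse M = Some N"
proof -
  have NM: "N * M = 1\<^sub>m d" by (rule mat_mult_left_right_inverse[OF M N MN])
  have "M \<in> Units (ring_mat TYPE('a) d ())"
    using M N MN NM by (auto simp: Units_def ring_mat_simps)
  then obtain X where X: "mat_inverse M = Some X"
    using mat_inverse(1)[OF M, of "()"] by (cases "mat_inverse M") auto
  then have "M * X = 1\<^sub>m d" "X \<in> carrier_mat d d"
    using mat_inverse(2)[OF M] by auto
  then have "X = N"
    using assoc_mult_mat[OF N M, of X d] NM N by simp
  with X show ?thesis by simp
qed

section \<open>Contiguous submatrices as blocks\<close>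

lemma pick_atLeastLessThan:
  assumes "i < b - a"
  shows "pick {a..<b} i = i + a"
proof -
  have "{x \<in> {a..<b}. x < a + i} = {a..<a + i}" using assms by auto
  then show ?thesis using assms pick_card_in_set[of "a + i" "{a..<b}"] by (simp add: add.commute)
qed

lemma submatrix_atLeastLessThan:
  assumes "b \<le> dim_row M" "d \<le> dim_col M"
  shows "submatrix M {a..<b} {c..<d} = mat (b - a) (d - c) (\<lambda>(i, j). M $$ (i + a, j + c))"
proof -
  have sets: "{i. i < dim_row M \<and> i \<in> {a..<b}} = {a..<b}" "{j. j < dim_col M \<and> j \<in> {c..<d}} = {c..<d}"
    using assms by auto
  show ?thesis
    unfolding submatrix_def sets by (rule eq_matI) (simp_all add: pick_atLeastLessThan)
qed

text \<open>
  The next two lemmas turn the submatrices \<open>R\<close> and \<open>P\<close>, given by index sets, into corners of a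
  block decomposition, on which products can be computed blockwise.
\<close>

lemma leading_submatrix_block:
  assumes M: "M \<in> carrier_mat m m" and k: "k \<le> m"
  obtains M2 M3 M4 where
    "M = four_block_mat (submatrix M {..<k} {..<k}) M2 M3 M4"
    "submatrix M {..<k} {..<k} \<in> carrier_mat k k" "M2 \<in> carrier_mat k (m - k)"
    "M3 \<in> carrier_mat (m - k) k" "M4 \<in> carrier_mat (m - k) (m - k)"
proof -
  obtain M1 M2 M3 M4 where s: "split_block M k k = (M1, M2, M3, M4)"
    using prod_cases4 by blast
  have eq: "submatrix M {..<k} {..<k} = M1"
    using submatrix_atLeastLessThan[of k M k 0 0] s M k
    by (auto simp: split_block_def Let_def lessThan_atLeast0)
  have d: "dim_row M = k + (m - k)" "dim_col M = k + (m - k)" using M k by auto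
  show thesis by (rule that[unfolded eq, OF split_block(5,1-4)[OF s d]])
qed

lemma trailing_submatrix_block:
  assumes M: "M \<in> carrier_mat n n" and k: "k \<le> n"
  obtains M1 M2 M3 where
    "M = four_block_mat M1 M2 M3 (submatrix M {n - k..<n} {n - k..<n})"
    "M1 \<in> carrier_mat (n - k) (n - k)" "M2 \<in> carrier_mat (n - k) k"
    "M3 \<in> carrier_mat k (n - k)" "submatrix M {n - k..<n} {n - k..<n} \<in> carrier_mat k k"
proof -
  obtain M1 M2 M3 M4 where s: "split_block M (n - k) (n - k) = (M1, M2, M3, M4)"
    using prod_cases4 by blast
  have "submatrix M {n - k..<n} {n - k..<n} =
      mat k k (\<lambda>(i, j). M $$ (i + (n - k), j + (n - k)))"
    using M k by (subst submatrix_atLeastLessThan) simp_all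
  also have "\<dots> = M4"
    using s M k unfolding split_block_def Let_def by simp
  finally have eq: "submatrix M {n - k..<n} {n - k..<n} = M4" .
  have d: "dim_row M = (n - k) + k" "dim_col M = (n - k) + k" using M k by auto
  show thesis by (rule that[unfolded eq, OF split_block(5,1-4)[OF s d]])
qed

section \<open>Inverting a block matrix through its Schur complement\<close>

text \<open>
  The block form of the inverse of \<open>[[A, H], [G, B]]\<close>, where \<open>A'\<close> stands for \<open>A\<^sup>-\<^sup>1\<close> and
  \<open>T\<close> for the inverse of the Schur complement \<open>B - G A\<^sup>-\<^sup>1 H\<close>. It contains no division
  besides those hidden in \<open>A'\<close> and \<open>T\<close>.
\<close>

definition schur_inverse ::
    "'a :: ring mat \<Rightarrow> 'a mat \<Rightarrow> 'a mat \<Rightarrow> 'a mat \<Rightarrow> 'a mat" where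
  "schur_inverse A' H G T = four_block_mat
     (A' + A' * (H * (T * (G * A')))) (- (A' * (H * T)))
     (- (T * (G * A'))) T"

lemma schur_inverse_carrier:
  "A' \<in> carrier_mat n n \<Longrightarrow> T \<in> carrier_mat m m \<Longrightarrow>
    schur_inverse A' H G T \<in> carrier_mat (n + m) (n + m)"
  unfolding schur_inverse_def by (intro carrier_matI) auto

lemma schur_inverse_Ints:
  fixes A' :: "'a :: ring_1 mat"
  assumes c: "A' \<in> carrier_mat n n" "H \<in> carrier_mat n m" "G \<in> carrier_mat m n"
    "T \<in> carrier_mat m m"
    and i: "elements_mat A' \<subseteq> \<int>" "elements_mat H \<subseteq> \<int>" "elements_mat G \<subseteq> \<int>"
    "elements_mat T \<subseteq> \<int>"
  shows "elements_mat (schur_inverse A' H G T) \<subseteq> \<int>"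
proof -
  note GA = mult_carrier_mat[OF c(3,1)] elements_mat_mult_Ints[OF c(3,1) i(3,1)]
  note TGA = mult_carrier_mat[OF c(4) GA(1)] elements_mat_mult_Ints[OF c(4) GA(1) i(4) GA(2)]
  note HTGA = mult_carrier_mat[OF c(2) TGA(1)] elements_mat_mult_Ints[OF c(2) TGA(1) i(2) TGA(2)]
  note AHTGA = mult_carrier_mat[OF c(1) HTGA(1)] elements_mat_mult_Ints[OF c(1) HTGA(1) i(1) HTGA(2)]
  note HT = mult_carrier_mat[OF c(2,4)] elements_mat_mult_Ints[OF c(2,4) i(2,4)]
  note AHT = mult_carrier_mat[OF c(1) HT(1)] elements_mat_mult_Ints[OF c(1) HT(1) i(1) HT(2)]
  show ?thesis
    unfolding schur_inverse_def
    by (rule elements_mat_four_block_subset[OF add_carrier_mat[OF AHTGA(1)]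
          uminus_carrier_mat[OF AHT(1)] uminus_carrier_mat[OF TGA(1)] c(4)
          elements_mat_add_Ints[OF c(1) AHTGA(1) i(1) AHTGA(2)]
          elements_mat_uminus_Ints[OF AHT(2)] elements_mat_uminus_Ints[OF TGA(2)] i(4)])
qed

lemma add_uminus_cancel_mat:
  fixes X Y :: "'a :: ab_group_add mat"
  assumes "X \<in> carrier_mat r c" "Y \<in> carrier_mat r c"
  shows "Y + X + - X = Y" "- X + (Y + X) = Y" "X + - X = 0\<^sub>m r c" "Y - X + X = Y"
  using assms by (auto intro!: eq_matI)

text \<open>
  Block elimination. Rewriting the hypothesis on \<open>T\<close> as \<open>B T = 1 + G A' H T\<close> makes the four block
  products collapse; for example the lower right one is \<open>- G A' H T + B T = 1\<close>.
\<close>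

lemma four_block_mat_right_inverse:
  fixes A :: "'a :: comm_ring_1 mat"
  assumes c: "A \<in> carrier_mat n n" "A' \<in> carrier_mat n n" "H \<in> carrier_mat n m"
    "G \<in> carrier_mat m n" "B \<in> carrier_mat m m" "T \<in> carrier_mat m m"
    and A: "A * A' = 1\<^sub>m n" and T: "(B - G * (A' * H)) * T = 1\<^sub>m m"
  shows "four_block_mat A H G B * schur_inverse A' H G T = 1\<^sub>m (n + m)"
proof -
  have AX: "A * (A' * X) = X" if "X \<in> carrier_mat n d" for X d
    using assoc_mult_mat[OF c(1,2) that] A that by simp
  have BT: "B * T = 1\<^sub>m m + G * (A' * (H * T))"
  proof -
    have Y: "G * (A' * (H * T)) \<in> carrier_mat m m" and BT: "B * T \<in> carrier_mat m m" using c by auto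
    have "B * T - G * (A' * (H * T)) = 1\<^sub>m m"
      unfolding T[symmetric] using c
      by (simp add: minus_mult_distrib_mat[of _ m m _ _ m] assoc_mult_mat[of _ m n _ m _ m]
        assoc_mult_mat[of _ n n _ m _ m])
    with add_uminus_cancel_mat(4)[OF Y BT] show ?thesis by simp
  qed
  have BTX: "B * (T * X) = X + G * (A' * (H * (T * X)))" if X: "X \<in> carrier_mat m d" for X d
  proof -
    have "B * (T * X) = (1\<^sub>m m + G * (A' * (H * T))) * X"
      using assoc_mult_mat[OF c(5,6) X] BT by simp
    also have "\<dots> = X + G * (A' * (H * (T * X)))"
      using c X by (simp add: add_mult_distrib_mat[of _ m m _ _ d] assoc_mult_mat[of _ m n _ m _ d]
        assoc_mult_mat[of _ n n _ m _ d] assoc_mult_mat[of _ n m _ m _ d])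
    finally show ?thesis .
  qed
  let ?X = "H * (T * (G * A'))"
  have X: "?X \<in> carrier_mat n n" and HT: "H * T \<in> carrier_mat n m"
    and GA: "G * A' \<in> carrier_mat m n" using c by auto
  have "A * (A' + A' * ?X) = 1\<^sub>m n + ?X"
    using c X A AX[OF X] by (simp add: mult_add_distrib_mat[of _ n n _ n])
  then have "A * (A' + A' * ?X) + H * (- (T * (G * A'))) = 1\<^sub>m n"
    using add_uminus_cancel_mat(1)[OF X one_carrier_mat] c by simp
  moreover have "A * (- (A' * (H * T))) + H * T = 0\<^sub>m n m"
    using HT AX[OF HT] c by simp
  moreover have "G * (A' + A' * ?X) + B * (- (T * (G * A'))) = 0\<^sub>m m n"
  proof -
    let ?Y = "G * A' + G * (A' * ?X)"
    have Y: "?Y \<in> carrier_mat m n" using c X by simp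
    have "G * (A' + A' * ?X) = ?Y"
      using c X by (intro mult_add_distrib_mat[of _ m n _ n]) simp_all
    moreover have "B * (- (T * (G * A'))) = - ?Y"
      using BTX[OF GA] c by simp
    ultimately show ?thesis using add_uminus_cancel_mat(3)[OF Y Y] by simp
  qed
  moreover have "G * (- (A' * (H * T))) + B * T = 1\<^sub>m m"
  proof -
    have "G * (A' * (H * T)) \<in> carrier_mat m m" using c by simp
    from add_uminus_cancel_mat(2)[OF this one_carrier_mat] show ?thesis
      unfolding BT using c by simp
  qed
  ultimately show ?thesis
    unfolding schur_inverse_def using c X by (subst mult_four_block_mat[of _ n n _ m _ m]) auto
qed

text \<open>
  If \<open>L\<^sup>2 = 0\<close>, the geometric series for \<open>(1 - L)\<^sup>-\<^sup>1\<close> stops after \<open>1 + L\<close>; if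
  \<open>L\<^sup>2 = 2 L\<close>, then \<open>(1 - L)\<^sup>2 = 1 - 2 L + L\<^sup>2 = 1\<close>. The explicit form of \<open>J\<close> is
  recorded because it shows that \<open>J\<close> has integer entries when \<open>L\<close> does.
\<close>

lemma one_minus_right_inverse:
  fixes L :: "'a :: comm_ring_1 mat"
  assumes L: "L \<in> carrier_mat d d" and sq: "L * L = 0\<^sub>m d d \<or> L * L = 2 \<cdot>\<^sub>m L"
  obtains J where "J = 1\<^sub>m d + L \<or> J = 1\<^sub>m d - L" "(1\<^sub>m d - L) * J = 1\<^sub>m d"
  using sq
proof
  assume "L * L = 0\<^sub>m d d"
  then have "(1\<^sub>m d - L) * (1\<^sub>m d + L) = 1\<^sub>m d"
    using L
    by (simp add: mult_add_distrib_mat[of _ d d _ d] minus_mult_distrib_mat[of _ d d _ _ d]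
        minus_carrier_mat)
      (auto simp: mat_eq_iff)
  then show thesis using that by blast
next
  assume "L * L = 2 \<cdot>\<^sub>m L"
  then have "(1\<^sub>m d - L) * (1\<^sub>m d - L) = 1\<^sub>m d"
    using L
    by (simp add: mult_minus_distrib_mat[of _ d d _ d] minus_mult_distrib_mat[of _ d d _ _ d]
        minus_carrier_mat)
      (auto simp: mat_eq_iff)
  then show thesis using that by blast
qed

section \<open>The bridge\<close>

lemma bridge_block_carrier:
  assumes "k \<le> n" "k \<le> m"
  shows "bridge_block n m k \<in> carrier_mat n m"
  using assms unfolding bridge_block_def
  by (metis four_block_carrier_mat le_add_diff_inverse le_add_diff_inverse2 one_carrier_mat
      zero_carrier_mat)

lemma elements_mat_bridge_block: "elements_mat (bridge_block n m k) \<subseteq> \<nat>"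
  unfolding bridge_block_def
  by (rule elements_mat_four_block_subset)
    (auto intro!: elements_mat_zero_subset elements_mat_one_subset)

text \<open>
  The only ones in the bridge block match the last \<open>k\<close> indices of the first graph with the first
  \<open>k\<close> indices of the second one, so the congruence transports exactly the trailing corner \<open>P\<close>
  to the leading position.
\<close>

lemma bridge_block_congruence:
  assumes k: "k \<le> n" "k \<le> m"
    and c: "M1 \<in> carrier_mat (n - k) (n - k)" "M2 \<in> carrier_mat (n - k) k"
    "M3 \<in> carrier_mat k (n - k)" "P \<in> carrier_mat k k"
  shows "transpose_mat (bridge_block n m k) * (four_block_mat M1 M2 M3 P * bridge_block n m k)
    = four_block_mat P (0\<^sub>m k (m - k)) (0\<^sub>m (m - k) k) (0\<^sub>m (m - k) (m - k))"
proof -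
  have t: "transpose_mat (bridge_block n m k) =
      four_block_mat (0\<^sub>m k (n - k)) (1\<^sub>m k) (0\<^sub>m (m - k) (n - k)) (0\<^sub>m (m - k) k)"
    unfolding bridge_block_def by (subst transpose_four_block_mat) auto
  have "four_block_mat M1 M2 M3 P * bridge_block n m k =
      four_block_mat M2 (0\<^sub>m (n - k) (m - k)) P (0\<^sub>m k (m - k))"
    unfolding bridge_block_def using c
    by (subst mult_four_block_mat[of _ "n - k" "n - k" _ k _ k _ _ k _ "m - k"]) auto
  then show ?thesis
    unfolding t using c
    by (simp, subst mult_four_block_mat[of _ k "n - k" _ k _ "m - k" _ _ k _ "m - k"]) auto
qed

text \<open>
  The lower block row of \<open>L\<close> vanishes, so squaring \<open>L\<close> multiplies its upper block row from the
  left by \<open>P R\<close>. Therefore \<open>P R = c I\<close> implies \<open>L\<^sup>2 = c L\<close>, here for \<open>c = 0\<close> and \<open>c = 2\<close>.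
\<close>

lemma corner_product_square:
  fixes P R :: "'a :: comm_ring_1 mat"
  assumes c: "P \<in> carrier_mat k k" "R \<in> carrier_mat k k" "N2 \<in> carrier_mat k l"
    "N3 \<in> carrier_mat l k" "N4 \<in> carrier_mat l l"
    and PR: "P * R = 0\<^sub>m k k \<or> P * R = 2 \<cdot>\<^sub>m 1\<^sub>m k"
  defines "L \<equiv> four_block_mat P (0\<^sub>m k l) (0\<^sub>m l k) (0\<^sub>m l l) * four_block_mat R N2 N3 N4"
  shows "L * L = 0\<^sub>m (k + l) (k + l) \<or> L * L = 2 \<cdot>\<^sub>m L"
proof -
  have L: "L = four_block_mat (P * R) (P * N2) (0\<^sub>m l k) (0\<^sub>m l l)"
    unfolding L_def using c by (subst mult_four_block_mat[of _ k k _ l _ l _ _ k _ l]) auto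
  have LL: "L * L = four_block_mat (P * R * (P * R)) (P * R * (P * N2)) (0\<^sub>m l k) (0\<^sub>m l l)"
    unfolding L using c by (subst mult_four_block_mat[of _ k k _ l _ l _ _ k _ l]) auto
  have PN: "P * N2 \<in> carrier_mat k l" using c by simp
  from PR show ?thesis
  proof
    assume "P * R = 0\<^sub>m k k"
    then have "L * L = 0\<^sub>m (k + l) (k + l)" unfolding LL using left_mult_zero_mat[OF PN] by simp
    then show ?thesis ..
  next
    assume "P * R = 2 \<cdot>\<^sub>m 1\<^sub>m k"
    then have "L * L = 2 \<cdot>\<^sub>m L"
      unfolding LL using PN unfolding L
      by (simp add: mult_smult_assoc_mat[of _ k k _ k] mult_smult_assoc_mat[of _ k k _ l])
        (auto simp: mat_eq_iff)
    then show ?thesis ..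
  qed
qed

lemma bridge_eq:
  assumes "A \<in> carrier_mat n n" "B \<in> carrier_mat m m"
  shows "bridge k A B =
    four_block_mat A (bridge_block n m k) (transpose_mat (bridge_block n m k)) B"
  using assms unfolding bridge_def by (simp add: Let_def)

lemma adjacency_matrix_bridge:
  assumes A: "adjacency_matrix n A" and B: "adjacency_matrix m B" and k: "k \<le> n" "k \<le> m"
  shows "adjacency_matrix (n + m) (bridge k A B)"
proof -
  note H = bridge_block_carrier[OF k]
  have Ac: "A \<in> carrier_mat n n" "transpose_mat A = A" "elements_mat A \<subseteq> \<nat>"
    and Bc: "B \<in> carrier_mat m m" "transpose_mat B = B" "elements_mat B \<subseteq> \<nat>"
    using A B unfolding adjacency_matrix_def by auto
  have HT: "transpose_mat (bridge_block n m k) \<in> carrier_mat m n" using H by simp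
  show ?thesis
    unfolding adjacency_matrix_def bridge_eq[OF Ac(1) Bc(1)]
    using Ac Bc transpose_four_block_mat[OF Ac(1) H HT Bc(1)]
      elements_mat_four_block_subset[OF Ac(1) H HT Bc(1), of \<nat>] elements_mat_bridge_block
    by (simp add: elements_mat_transpose)
qed

theorem theorem2:
  fixes A B P R :: "real mat" and n m k :: nat
  assumes "adjacency_matrix n A" and "adjacency_matrix m B"
    and "integrally_invertible A" and "integrally_invertible B"
    and "1 \<le> k" and "k \<le> min n m"
    and "R = submatrix (the (mat_inverse B)) {..<k} {..<k}"
    and "P = submatrix (the (mat_inverse A)) {n - k..<n} {n - k..<n}"
    and "P * R = 0\<^sub>m k k \<or> P * R = 2 \<cdot>\<^sub>m 1\<^sub>m k"
  shows "adjacency_matrix (n + m) (bridge k A B) \<and> integrally_invertible (bridge k A B)"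
proof
  have k: "k \<le> n" "k \<le> m" using assms(6) by auto
  show "adjacency_matrix (n + m) (bridge k A B)"
    by (rule adjacency_matrix_bridge[OF assms(1,2) k])
  have Ac: "A \<in> carrier_mat n n" and Bc: "B \<in> carrier_mat m m"
    using assms(1,2) unfolding adjacency_matrix_def by auto
  obtain A' where A': "mat_inverse A = Some A'" "elements_mat A' \<subseteq> \<int>"
    using assms(3) unfolding integrally_invertible_def by blast
  obtain B' where B': "mat_inverse B = Some B'" "elements_mat B' \<subseteq> \<int>"
    using assms(4) unfolding integrally_invertible_def by blast
  have AA': "A * A' = 1\<^sub>m n" "A' \<in> carrier_mat n n"
    using mat_inverse(2)[OF Ac A'(1)] by auto
  have BB': "B * B' = 1\<^sub>m m" "B' * B = 1\<^sub>m m" "B' \<in> carrier_mat m m"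
    using mat_inverse(2)[OF Bc B'(1)] by auto
  define H :: "real mat" where "H = bridge_block n m k"
  define G where "G = transpose_mat H"
  have Hc: "H \<in> carrier_mat n m" unfolding H_def by (rule bridge_block_carrier[OF k])
  have Gc: "G \<in> carrier_mat m n" unfolding G_def using Hc by simp
  have Hi: "elements_mat H \<subseteq> \<int>"
    unfolding H_def using elements_mat_bridge_block Nats_subset_Ints by blast
  have Gi: "elements_mat G \<subseteq> \<int>" unfolding G_def using Hi by (simp add: elements_mat_transpose)
  define L where "L = G * (A' * H) * B'"
  have Lc: "L \<in> carrier_mat m m"
    unfolding L_def
    by (rule mult_carrier_mat[OF mult_carrier_mat[OF Gc mult_carrier_mat[OF AA'(2) Hc]] BB'(3)])
  have "L * L = 0\<^sub>m m m \<or> L * L = 2 \<cdot>\<^sub>m L"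
  proof -
    have P: "P = submatrix A' {n - k..<n} {n - k..<n}" and R: "R = submatrix B' {..<k} {..<k}"
      using assms(7,8) A' B' by auto
    obtain M1 M2 M3 where M: "A' = four_block_mat M1 M2 M3 P"
        "M1 \<in> carrier_mat (n - k) (n - k)" "M2 \<in> carrier_mat (n - k) k"
        "M3 \<in> carrier_mat k (n - k)" "P \<in> carrier_mat k k"
      using trailing_submatrix_block[OF AA'(2) k(1)] unfolding P by blast
    obtain N2 N3 N4 where N: "B' = four_block_mat R N2 N3 N4" "R \<in> carrier_mat k k"
        "N2 \<in> carrier_mat k (m - k)" "N3 \<in> carrier_mat (m - k) k" "N4 \<in> carrier_mat (m - k) (m - k)"
      using leading_submatrix_block[OF BB'(3) k(2)] unfolding R by blast
    show ?thesis
      using corner_product_square[OF M(5) N(2-5) assms(9)] bridge_block_congruence[OF k M(2-5)] k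
      unfolding L_def G_def H_def M(1) N(1) by simp
  qed
  then obtain J where J: "J = 1\<^sub>m m + L \<or> J = 1\<^sub>m m - L" "(1\<^sub>m m - L) * J = 1\<^sub>m m"
    using one_minus_right_inverse[OF Lc] by metis
  have Jc: "J \<in> carrier_mat m m" using J(1) Lc by auto
  \<comment> \<open>The Schur complement is \<open>(1 - L) B\<close>, so its inverse is \<open>B\<^sup>-\<^sup>1 (1 - L)\<^sup>-\<^sup>1\<close>.\<close>
  define T where "T = B' * J"
  have Tc: "T \<in> carrier_mat m m" unfolding T_def using BB' Jc by simp
  have T: "(B - G * (A' * H)) * T = 1\<^sub>m m"
  proof -
    have "(B - G * (A' * H)) * T = (B - G * (A' * H)) * B' * J"
      unfolding T_def using Gc Hc AA' BB' Bc Jc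
      by (intro assoc_mult_mat[symmetric, of _ m m _ m _ m]) auto
    also have "(B - G * (A' * H)) * B' = 1\<^sub>m m - L"
      unfolding L_def BB'(1)[symmetric] using Gc Hc AA' BB' Bc
      by (intro minus_mult_distrib_mat[of _ m m _ _ m]) auto
    finally show ?thesis using J(2) by simp
  qed
  have "bridge k A B * schur_inverse A' H G T = 1\<^sub>m (n + m)"
    using four_block_mat_right_inverse[OF Ac AA'(2) Hc Gc Bc Tc AA'(1) T] bridge_eq[OF Ac Bc]
    unfolding H_def G_def by simp
  moreover have "bridge k A B \<in> carrier_mat (n + m) (n + m)"
    using adjacency_matrix_bridge[OF assms(1,2) k] unfolding adjacency_matrix_def by simp
  ultimately have inv: "mat_inverse (bridge k A B) = Some (schur_inverse A' H G T)"
    using schur_inverse_carrier[OF AA'(2) Tc] by (intro mat_inverse_eq_SomeI)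
  have "elements_mat L \<subseteq> \<int>"
    unfolding L_def using Gc Hc AA' BB' Gi Hi A'(2) B'(2)
    by (meson elements_mat_mult_Ints mult_carrier_mat)
  then have "elements_mat J \<subseteq> \<int>"
    using J(1)
      elements_mat_add_Ints[OF one_carrier_mat Lc elements_mat_one_subset[OF Ints_0 Ints_1]]
      elements_mat_minus_Ints[OF one_carrier_mat Lc elements_mat_one_subset[OF Ints_0 Ints_1]]
    by metis
  then have "elements_mat T \<subseteq> \<int>"
    unfolding T_def using elements_mat_mult_Ints[OF BB'(3) Jc B'(2)] by blast
  then have "elements_mat (schur_inverse A' H G T) \<subseteq> \<int>"
    by (rule schur_inverse_Ints[OF AA'(2) Hc Gc Tc A'(2) Hi Gi])
  with inv show "integrally_invertible (bridge k A B)"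
    unfolding integrally_invertible_def by blast
qed

end
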